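(* Let $X$ be a non-empty finite set, let $C$ be a family of subsets of $X$ with $|C|\ge 2$, let $Z=X\times\{0,1\}$, and let $c\models(x,b)$ if and only if ($b=1$ and $x\in c$) or ($b=0$ and $x\notin c$). Then $\mathrm{MLE\text{-}TD}(C)\le\mathrm{VCdim}(C)$, where $\mathrm{VCdim}(C)$ is the VC-dimension of $C$.
   Context: $\mathrm{MLE\text{-}TD}(C)$ here refers to unordered sampling without replacement and is defined as follows. For a probability vector $Q=(q(z))_{z\in Z}$ and a set $A=\{z_1,\dots,z_n\}\subseteq Z$ of size $n\le|\{z:q(z)>0\}|$, $P^{\overline{O},\overline{R}}(A|Q)=\sum_\sigma\prod_{i=1}^n \frac{q(z_{\sigma(i)})}{1-(q(z_{\sigma(1)})+\dots+q(z_{\sigma(i-1)}))}$ over all permutations $\sigma$ of $\{1,\dots,n\}$ (equal to $1$ for $A=\emptyset$). An MLE-learner $L$ for $C$ is given by conditional likelihoods $P(z|c)\ge 0$ with $\sum_{z\in Z}P(z|c)=1$ for each $c\in C$, such that $c\not\models z$ implies $P(z|c)=0$. Let $N^+(C,L)=\min_{c\in C}|\{z\in Z:P(z|c)>0\}|$. A teacher for $L$ is a map $T:C\to 2^Z$ such that for every $c_0\in C$: $|T(c_0)|\le N^+(C,L)$ and $c_0$ is the unique maximizer over $c\in C$ of $P^{\overline{O},\overline{R}}(T(c_0)|P(\cdot|c))$. The order of $T$ is $\max_{c\in C}|T(c)|$. $\mathrm{MLE\text{-}TD}(C)$ is the smallest $d$ such that some MLE-learner for $C$ has a teacher of order $d$.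 $\mathrm{VCdim}(C)$ is the size of a largest $S\subseteq X$ shattered by $C$, i.e., such that every $b:S\to\{0,1\}$ coincides on $S$ with the indicator function of some $c\in C$. *)

theory Defs
  imports Complex_Main "HOL-Combinatorics.Multiset_Permutations" "HOL-Library.Extended_Nat"
begin

(* The summation ranges over all orderings of A.  The denominators are positive whenever
   Q is a probability vector with at least card A positive entries. *)
definition sample_lik :: "('z \<Rightarrow> real) \<Rightarrow> 'z set \<Rightarrow> real" where
  "sample_lik Q A =
     (\<Sum>zs\<in>permutations_of_set A. \<Prod>i<card A. Q (zs ! i) / (1 - (\<Sum>j<i. Q (zs ! j))))"

(* P c z is the conditional likelihood P(z|c); only its values for c in C and z in Z matter. *)
definition MLE_learner ::
    "'z set \<Rightarrow> 'c set \<Rightarrow> ('c \<Rightarrow> 'z \<Rightarrow> bool) \<Rightarrow> ('c \<Rightarrow> 'z \<Rightarrow> real) \<Rightarrow> bool" where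
  "MLE_learner Z C models P \<longleftrightarrow>
     (\<forall>c\<in>C. (\<forall>z\<in>Z. 0 \<le> P c z) \<and> (\<Sum>z\<in>Z. P c z) = 1 \<and>
             (\<forall>z\<in>Z. \<not> models c z \<longrightarrow> P c z = 0))"

definition N_plus :: "'z set \<Rightarrow> 'c set \<Rightarrow> ('c \<Rightarrow> 'z \<Rightarrow> real) \<Rightarrow> nat" where
  "N_plus Z C P = (MIN c\<in>C. card {z \<in> Z. P c z > 0})"

definition teacher ::
    "'z set \<Rightarrow> 'c set \<Rightarrow> ('c \<Rightarrow> 'z \<Rightarrow> real) \<Rightarrow> ('c \<Rightarrow> 'z set) \<Rightarrow> bool" where
  "teacher Z C P T \<longleftrightarrow>
     (\<forall>c\<^sub>0\<in>C. T c\<^sub>0 \<subseteq> Z \<and> card (T c\<^sub>0) \<le> N_plus Z C P \<and>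
        {c. is_arg_max (\<lambda>c. sample_lik (P c) (T c\<^sub>0)) (\<lambda>c. c \<in> C) c} = {c\<^sub>0})"

definition teacher_order :: "'c set \<Rightarrow> ('c \<Rightarrow> 'z set) \<Rightarrow> nat" where
  "teacher_order C T = (MAX c\<in>C. card (T c))"

(* Valued in enat so that the value is \<infinity> if no learner has a teacher; an upper bound by a
   natural number thus includes the existence of a learner and a teacher. *)
definition MLE_TD :: "'z set \<Rightarrow> 'c set \<Rightarrow> ('c \<Rightarrow> 'z \<Rightarrow> bool) \<Rightarrow> enat" where
  "MLE_TD Z C models =
     Inf {enat d | d. \<exists>P T. MLE_learner Z C models P \<and> teacher Z C P T \<and> teacher_order C T = d}"

(* Labels 1 and 0 are True and False. *)
definition labeled_examples :: "'a set \<Rightarrow> ('a \<times> bool) set" where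
  "labeled_examples X = X \<times> UNIV"

definition consistent :: "'a set \<Rightarrow> 'a \<times> bool \<Rightarrow> bool" where
  "consistent c z \<longleftrightarrow> (case z of (x, b) \<Rightarrow> (b \<and> x \<in> c) \<or> (\<not> b \<and> x \<notin> c))"

definition shatters :: "'a set set \<Rightarrow> 'a set \<Rightarrow> bool" where
  "shatters C S \<longleftrightarrow> (\<forall>b :: 'a \<Rightarrow> bool. \<exists>c\<in>C. \<forall>x\<in>S. b x \<longleftrightarrow> x \<in> c)"

definition VCdim :: "'a set \<Rightarrow> 'a set set \<Rightarrow> nat" where
  "VCdim X C = Max {card S | S. S \<subseteq> X \<and> shatters C S}"

end

theory Submission imports Defs begin

text \<open>
  By induction on \<open>X\<close> there is an injective map \<open>T\<close> sending each concept to a nonempty set of at most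
  \<open>VCdim X C\<close> labeled examples consistent with it: a concept containing the new point \<open>x\<close> whose
  partner without \<open>x\<close> also lies in \<open>C\<close> is taught by \<open>(x, True)\<close> together with a sample for the class
  of such pairs, whose VC-dimension is smaller by one; all other concepts are taught by samples for the
  projection of the class.

  Given \<open>T\<close>, let \<open>P c\<close> be proportional to a large number \<open>M\<close> on \<open>T c\<close> and to \<open>1\<close> on the other examples
  consistent with \<open>c\<close>. Then \<open>T c\<close> has likelihood greater than \<open>1/2\<close> under \<open>c\<close>. If \<open>c' \<noteq> c\<close>, then \<open>T c\<close> is
  inconsistent with \<open>c'\<close> or one of its elements can be exchanged for an outside example that is at
  least as likely under \<open>c'\<close>. The exchange does not decrease the likelihood, and the likelihoods of
  the two sets add up to at most \<open>1\<close>, so \<open>T c\<close> has likelihood at most \<open>1/2\<close> under \<open>c'\<close>.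
\<close>

section \<open>Sampling without replacement\<close>

text \<open>One summand of \<open>sample_lik\<close>; the number of factors is read off the list,
  which suits induction by appending a draw.\<close>

definition seq_lik :: "('z \<Rightarrow> real) \<Rightarrow> 'z list \<Rightarrow> real" where
  "seq_lik Q zs = (\<Prod>i<length zs. Q (zs ! i) / (1 - (\<Sum>j<i. Q (zs ! j))))"

lemma sample_lik_eq: "sample_lik Q A = (\<Sum>zs\<in>permutations_of_set A. seq_lik Q zs)"
  unfolding sample_lik_def seq_lik_def
  by (intro sum.cong refl) (simp add: length_finite_permutations_of_set)

lemma sum_nth_eq_sum_list_set:
  assumes "distinct zs"
  shows "(\<Sum>j<length zs. f (zs ! j)) = sum f (set zs)"
  by (rule sum.reindex_bij_betw[OF bij_betw_nth[OF assms refl refl]])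

lemma sum_nth_eq_sum_set:
  assumes "distinct zs" "i \<le> length zs"
  shows "(\<Sum>j<i. f (zs ! j)) = sum f (set (take i zs))"
  using sum_nth_eq_sum_list_set[of "take i zs" f] assms by (simp add: min_absorb2)

lemma seq_lik_snoc:
  assumes "distinct zs"
  shows "seq_lik Q (zs @ [z]) = seq_lik Q zs * (Q z / (1 - sum Q (set zs)))"
proof -
  have "(\<Sum>j<length zs. Q ((zs @ [z]) ! j)) = sum Q (set zs)"
    using sum_nth_eq_sum_list_set[OF assms, of Q] by (simp add: nth_append)
  then show ?thesis
    unfolding seq_lik_def by (simp add: nth_append)
qed

locale distribution =
  fixes Z :: "'z set" and Q :: "'z \<Rightarrow> real"
  assumes finite: "finite Z"
    and nonneg: "\<And>z. z \<in> Z \<Longrightarrow> 0 \<le> Q z"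
    and sum_eq_1: "sum Q Z = 1"
begin

lemma sum_le_1: "A \<subseteq> Z \<Longrightarrow> sum Q A \<le> 1"
  using sum_mono2[OF finite, of A Q] nonneg sum_eq_1 by auto

lemma prefix_le_1:
  assumes "distinct zs" "set zs \<subseteq> Z" "i \<le> length zs"
  shows "(\<Sum>j<i. Q (zs ! j)) \<le> 1"
  using assms by (subst sum_nth_eq_sum_set) (auto intro!: sum_le_1 dest: in_set_takeD)

lemma factor_nonneg:
  assumes "distinct zs" "set zs \<subseteq> Z" "i < length zs"
  shows "0 \<le> Q (zs ! i) / (1 - (\<Sum>j<i. Q (zs ! j)))"
  using prefix_le_1[of zs i] nonneg[OF subsetD[OF assms(2) nth_mem[OF assms(3)]]] assms by simp

lemma seq_lik_nonneg: "distinct zs \<Longrightarrow> set zs \<subseteq> Z \<Longrightarrow> 0 \<le> seq_lik Q zs"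
  unfolding seq_lik_def by (intro prod_nonneg) (auto intro: factor_nonneg)

definition samples :: "nat \<Rightarrow> 'z list set" where
  "samples n = {zs. distinct zs \<and> set zs \<subseteq> Z \<and> length zs = n}"

lemma finite_samples: "finite (samples n)"
  using finite_lists_length_eq[OF finite, of n] by (rule rev_finite_subset) (auto simp: samples_def)

lemma samples_Suc:
  "samples (Suc n) = (\<lambda>(zs, z). zs @ [z]) ` (SIGMA zs:samples n. Z - set zs)"
proof
  show "samples (Suc n) \<subseteq> (\<lambda>(zs, z). zs @ [z]) ` (SIGMA zs:samples n. Z - set zs)"
  proof
    fix ys assume "ys \<in> samples (Suc n)"
    then show "ys \<in> (\<lambda>(zs, z). zs @ [z]) ` (SIGMA zs:samples n. Z - set zs)"
      by (cases ys rule: rev_cases) (auto simp: samples_def image_iff)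
  qed
qed (auto simp: samples_def)

text \<open>Summed over all remaining examples, one more draw multiplies the weight by
  \<open>(1 - s) / (1 - s)\<close>, with \<open>s\<close> the mass already drawn. For
  \<open>s = 1\<close> this is 0 by the convention for division by 0, hence an inequality.\<close>

lemma sum_seq_lik_le_1: "(\<Sum>zs\<in>samples n. seq_lik Q zs) \<le> 1"
proof (induction n)
  case 0
  have "samples 0 = {[]}" by (auto simp: samples_def)
  then show ?case by (simp add: seq_lik_def)
next
  case (Suc n)
  have "(\<Sum>zs\<in>samples (Suc n). seq_lik Q zs)
      = (\<Sum>(zs, z)\<in>(SIGMA zs:samples n. Z - set zs). seq_lik Q (zs @ [z]))"
    unfolding samples_Suc by (subst sum.reindex) (auto simp: inj_on_def intro!: sum.cong)
  also have "\<dots> = (\<Sum>zs\<in>samples n. \<Sum>z\<in>Z - set zs. seq_lik Q (zs @ [z]))"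
    using finite finite_samples by (subst sum.Sigma) auto
  also have "\<dots> \<le> (\<Sum>zs\<in>samples n. seq_lik Q zs)"
  proof (rule sum_mono)
    fix zs assume "zs \<in> samples n"
    then have zs: "distinct zs" "set zs \<subseteq> Z" by (auto simp: samples_def)
    have "sum Q (Z - set zs) = 1 - sum Q (set zs)"
      using zs finite sum_eq_1 by (subst sum_diff) auto
    then have "(\<Sum>z\<in>Z - set zs. seq_lik Q (zs @ [z]))
        = seq_lik Q zs * ((1 - sum Q (set zs)) / (1 - sum Q (set zs)))"
      using zs by (simp add: seq_lik_snoc sum_distrib_left[symmetric] sum_divide_distrib[symmetric])
    also have "\<dots> \<le> seq_lik Q zs * 1"
      using seq_lik_nonneg[OF zs] by (intro mult_left_mono) (auto simp: divide_simps)
    finally show "(\<Sum>z\<in>Z - set zs. seq_lik Q (zs @ [z])) \<le> seq_lik Q zs" by simp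
  qed
  finally show ?case using Suc.IH by linarith
qed

text \<open>The orderings of \<open>A\<close> and of \<open>B\<close> are disjoint families of draws
  of the same length.\<close>

lemma sample_lik_add_le_1:
  assumes "A \<subseteq> Z" "B \<subseteq> Z" "card A = card B" "A \<noteq> B"
  shows "sample_lik Q A + sample_lik Q B \<le> 1"
proof -
  have fin: "finite A" "finite B"
    using assms finite finite_subset by auto
  have "sample_lik Q A + sample_lik Q B
      = (\<Sum>zs\<in>permutations_of_set A \<union> permutations_of_set B. seq_lik Q zs)"
    unfolding sample_lik_eq using fin assms(4)
    by (subst sum.union_disjoint) (auto dest: permutations_of_setD)
  also have "\<dots> \<le> (\<Sum>zs\<in>samples (card A). seq_lik Q zs)"
    using assms finite_samples
    by (intro sum_mono2)
       (auto simp: samples_def permutations_of_set_def distinct_card intro!: seq_lik_nonneg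
         dest: distinct_card)
  also have "\<dots> \<le> 1" by (rule sum_seq_lik_le_1)
  finally show ?thesis .
qed

text \<open>Raising the drawn probabilities raises numerators and prefix sums, and so lowers the
  denominators.\<close>

lemma seq_lik_map_mono:
  assumes zs: "distinct zs" "set zs \<subseteq> Z"
    and f: "inj_on f (set zs)" "f ` set zs \<subseteq> Z" "\<And>z. z \<in> set zs \<Longrightarrow> Q z \<le> Q (f z)"
  shows "seq_lik Q zs \<le> seq_lik Q (map f zs)"
proof -
  have ys: "distinct (map f zs)" "set (map f zs) \<subseteq> Z"
    using zs f by (auto simp: distinct_map)
  show ?thesis
    unfolding seq_lik_def length_map
  proof (intro prod_mono conjI)
    fix i assume "i \<in> {..<length zs}"
    then have i: "i < length zs" by simp
    show "0 \<le> Q (zs ! i) / (1 - (\<Sum>j<i. Q (zs ! j)))"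
      by (rule factor_nonneg[OF zs i])
    have le: "Q (zs ! i) \<le> Q (map f zs ! i)" using f i by simp
    show "Q (zs ! i) / (1 - (\<Sum>j<i. Q (zs ! j)))
        \<le> Q (map f zs ! i) / (1 - (\<Sum>j<i. Q (map f zs ! j)))"
    proof (cases "Q (map f zs ! i) = 0")
      case True
      moreover have "zs ! i \<in> Z" using zs i by (metis nth_mem subsetD)
      ultimately have "Q (zs ! i) = 0" using le nonneg[of "zs ! i"] by simp
      then show ?thesis using True by simp
    next
      case False
      have "map f zs ! i \<in> Z" using ys i by (metis length_map nth_mem subsetD)
      then have pos: "0 < Q (map f zs ! i)" using nonneg False by fastforce
      \<comment> \<open>The prefix including element \<open>i\<close> has mass at most 1. As that
        element has positive mass, the denominator on the larger side is positive.\<close>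
      have "(\<Sum>j<Suc i. Q (map f zs ! j)) \<le> 1"
        using prefix_le_1[OF ys, of "Suc i"] i by simp
      then have "(\<Sum>j<i. Q (map f zs ! j)) < 1" using pos by simp
      moreover have "(\<Sum>j<i. Q (zs ! j)) \<le> (\<Sum>j<i. Q (map f zs ! j))"
        using f i by (intro sum_mono) auto
      ultimately show ?thesis
        using le pos by (intro frac_le) auto
    qed
  qed
qed

text \<open>Replacing \<open>a\<close> by \<open>t\<close> maps the orderings of \<open>A\<close>
  bijectively onto those of the exchanged set.\<close>

lemma sample_lik_exchange_mono:
  assumes "A \<subseteq> Z" "a \<in> A" "t \<in> Z - A" "Q a \<le> Q t"
  shows "sample_lik Q A \<le> sample_lik Q (insert t (A - {a}))"
proof -
  define f where "f = id(a := t)"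
  have f: "inj_on f A" using assms by (auto simp: f_def inj_on_def)
  have B: "insert t (A - {a}) = f ` A" using assms by (auto simp: f_def)
  have "sample_lik Q A \<le> (\<Sum>zs\<in>permutations_of_set A. seq_lik Q (map f zs))"
    unfolding sample_lik_eq
  proof (intro sum_mono seq_lik_map_mono)
    fix zs assume "zs \<in> permutations_of_set A"
    then have zs: "set zs = A" "distinct zs" by (auto simp: permutations_of_set_def)
    show "distinct zs" "set zs \<subseteq> Z" "inj_on f (set zs)" using zs f assms by auto
    show "f ` set zs \<subseteq> Z" using zs assms by (auto simp: f_def)
    show "Q z \<le> Q (f z)" for z using assms by (auto simp: f_def)
  qed
  also have "\<dots> = sample_lik Q (f ` A)"
    unfolding sample_lik_eq permutations_of_set_image_inj[OF f]
  proof (subst sum.reindex)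
    show "inj_on (map f) (permutations_of_set A)"
      by (rule inj_on_mapI, rule inj_on_subset[OF f]) (auto dest: permutations_of_setD)
  qed simp
  finally show ?thesis unfolding B .
qed

lemma sample_lik_le_half:
  assumes "A \<subseteq> Z" "a \<in> A" "t \<in> Z - A" "Q a \<le> Q t"
  shows "sample_lik Q A \<le> 1/2"
proof -
  have "finite A" using assms finite finite_subset by auto
  then have "card (insert t (A - {a})) = card A"
    using assms(2,3) card_Suc_Diff1[of A a] by simp
  then have "sample_lik Q A + sample_lik Q (insert t (A - {a})) \<le> 1"
    using assms by (intro sample_lik_add_le_1) auto
  then show ?thesis using sample_lik_exchange_mono[OF assms] by linarith
qed

text \<open>Let \<open>r\<close> be the mass outside \<open>T\<close>. While \<open>m\<close>
  elements of \<open>T\<close> remain, the next draw stays in \<open>T\<close> with probability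
  \<open>m * q / (m * q + r)\<close>, which is at least \<open>q / (q + r)\<close>. Bernoulli's
  inequality bounds the \<open>k\<close>-th power of this.\<close>

lemma sample_lik_gt_half:
  fixes q :: real
  assumes T: "T \<subseteq> Z" and q: "0 < q" "\<And>z. z \<in> T \<Longrightarrow> Q z = q"
    and small: "2 * real (card T) * (1 - card T * q) < q"
  shows "1/2 < sample_lik Q T"
proof -
  define k where "k = card T"
  define r where "r = 1 - k * q"
  have fin: "finite T" using T finite finite_subset by auto
  have r: "0 \<le> r" "2 * k * r < q"
    using sum_le_1[OF T] q(2) small by (auto simp: r_def k_def)
  have "1/2 < 1 - k * (r / (q + r))"
    using r q by (simp add: field_simps)
  also have "\<dots> \<le> (1 - r / (q + r)) ^ k"
    using Bernoulli_inequality[of "- (r / (q + r))" k] r q by (simp add: field_simps)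
  also have "\<dots> = (q / (q + r)) ^ k"
    using r q by (intro arg_cong[where f="\<lambda>x. x ^ k"]) (simp add: field_simps)
  \<comment> \<open>The bound is split evenly over the \<open>fact k\<close> orderings; writing
    \<open>fact k\<close> as the product of the \<open>k - i\<close> then allows a comparison factor
    by factor.\<close>
  also have "\<dots> = (\<Sum>zs\<in>permutations_of_set T. (q / (q + r)) ^ k / fact k)"
    using fin by (simp add: k_def)
  also have "\<dots> \<le> sample_lik Q T"
    unfolding sample_lik_eq
  proof (rule sum_mono)
    fix zs assume "zs \<in> permutations_of_set T"
    then have zs: "set zs = T" "distinct zs" "length zs = k"
      by (auto simp: permutations_of_set_def k_def distinct_card)
    have "(q / (q + r)) ^ k / fact k = (\<Prod>i<k. q / (q + r)) / (\<Prod>i<k. real (k - i))"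
      by (simp add: fact_prod_rev lessThan_atLeast0)
    also have "\<dots> = (\<Prod>i<k. q / (q + r) / real (k - i))"
      by (rule prod_dividef[symmetric])
    also have "\<dots> \<le> seq_lik Q zs"
      unfolding seq_lik_def zs(3)
    proof (intro prod_mono conjI)
      fix i assume "i \<in> {..<k}"
      then have i: "i < k" by simp
      show "0 \<le> q / (q + r) / real (k - i)" using r q by simp
      have "Q (zs ! i) = q" using zs i q(2) by (metis nth_mem)
      have "(\<Sum>j<i. Q (zs ! j)) = i * q"
        using zs i q(2) by (simp add: nth_mem[THEN q(2)[unfolded zs(1)[symmetric]]])
      then have den: "1 - (\<Sum>j<i. Q (zs ! j)) = real (k - i) * q + r"
        using i by (simp add: r_def of_nat_diff algebra_simps)
      \<comment> \<open>At least one element of \<open>T\<close> is left, since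
        \<open>i < k\<close>.\<close>
      have "r \<le> real (k - i) * r" using r i mult_right_mono[of 1 "real (k - i)" r] by simp
      then have "real (k - i) * q + r \<le> (q + r) * real (k - i)"
        by (simp add: algebra_simps)
      moreover have "0 < real (k - i) * q + r"
        using i q r by (intro add_pos_nonneg) auto
      ultimately have "q / ((q + r) * real (k - i)) \<le> q / (real (k - i) * q + r)"
        using q r i by (intro divide_left_mono mult_pos_pos) auto
      then show "q / (q + r) / real (k - i) \<le> Q (zs ! i) / (1 - (\<Sum>j<i. Q (zs ! j)))"
        using den \<open>Q (zs ! i) = q\<close> by simp
    qed
    finally show "(q / (q + r)) ^ k / fact k \<le> seq_lik Q zs" .
  qed
  finally show ?thesis .
qed

end

lemma sample_lik_eq_0:
  assumes "a \<in> A" "Q a = 0"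
  shows "sample_lik Q A = 0"
  unfolding sample_lik_eq
proof (intro sum.neutral ballI)
  fix zs assume "zs \<in> permutations_of_set A"
  then obtain i where "i < length zs" "zs ! i = a"
    using assms by (auto simp: permutations_of_set_def in_set_conv_nth)
  then show "seq_lik Q zs = 0"
    using assms unfolding seq_lik_def by (intro prod_zero) auto
qed

section \<open>A learner for an injective teaching map\<close>

text \<open>\<open>G c\<close> becomes the support of \<open>P c\<close>; the common size
  \<open>n\<close> makes \<open>N_plus\<close> equal to \<open>n\<close>, which admits every sample
  inside \<open>G c\<close>. Samples must be nonempty because the empty one has likelihood 1 under
  every concept.\<close>

lemma injective_map_is_teacher:
  fixes Z :: "'z set" and C :: "'c set" and G T :: "'c \<Rightarrow> 'z set"
  assumes fin: "finite Z" "finite C" and C: "C \<noteq> {}"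
    and G: "\<And>c. c \<in> C \<Longrightarrow> G c \<subseteq> Z" "\<And>c. c \<in> C \<Longrightarrow> card (G c) = n" "inj_on G C"
    and models: "\<And>c z. c \<in> C \<Longrightarrow> z \<in> G c \<Longrightarrow> models c z"
    and T: "\<And>c. c \<in> C \<Longrightarrow> T c \<subseteq> G c" "\<And>c. c \<in> C \<Longrightarrow> T c \<noteq> {}" "inj_on T C"
  obtains P where "MLE_learner Z C models P" "teacher Z C P T"
proof -
  \<comment> \<open>For \<open>k = card (T c)\<close>, the bound above 1/2 requires
    \<open>2 * k * (n - k) < M\<close>; the left side is at most \<open>2 * n * n\<close>.\<close>
  define M where "M = 2 * (real n)\<^sup>2 + 1"
  define w where "w c z = (if z \<in> T c then M else if z \<in> G c then 1 else 0)" for c z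
  define W where "W c = (\<Sum>z\<in>Z. w c z)" for c
  define P where "P c z = w c z / W c" for c z
  have M: "M \<ge> 1" by (simp add: M_def)
  have finG: "finite (G c)" if "c \<in> C" for c
    using finite_subset[OF G(1) fin(1)] that .
  have finT: "finite (T c)" if "c \<in> C" for c
    using finite_subset[OF T(1) finG] that by blast
  have W_eq: "W c = card (T c) * M + (n - card (T c))" if c: "c \<in> C" for c
  proof -
    have "W c = sum (w c) (G c)"
      unfolding W_def using G(1) T(1) c fin
      by (intro sum.mono_neutral_right) (auto simp: w_def)
    also have "\<dots> = sum (w c) (T c) + sum (w c) (G c - T c)"
      using T(1) c finG by (metis add.commute sum.subset_diff)
    also have "sum (w c) (T c) = card (T c) * M" by (simp add: w_def)
    also have "sum (w c) (G c - T c) = card (G c - T c)" by (simp add: w_def)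
    also have "card (G c - T c) = n - card (T c)"
      using T(1) c G(2) finT by (simp add: card_Diff_subset)
    finally show ?thesis .
  qed
  have cardT: "0 < card (T c)" "card (T c) \<le> n" if "c \<in> C" for c
    using T(1,2) finT G(2) finG that card_mono[of "G c" "T c"] by (auto simp: card_gt_0_iff)
  have W: "0 < W c" if "c \<in> C" for c
    using W_eq cardT M that by (simp add: add_pos_nonneg)
  have pos_iff: "0 < P c z \<longleftrightarrow> z \<in> G c" if "c \<in> C" for c z
    using W[OF that] T(1)[OF that] M by (auto simp: P_def w_def)
  have dist: "distribution Z (P c)" if "c \<in> C" for c
  proof
    show "finite Z" by (rule fin)
    show "0 \<le> P c z" for z using W[OF that] M by (auto simp: P_def w_def)
    show "sum (P c) Z = 1"
      using W[OF that] by (simp add: P_def sum_divide_distrib[symmetric] W_def)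
  qed
  have P_0: "P c z = 0" if "c \<in> C" "z \<notin> G c" for c z
    using T(1) that by (auto simp: P_def w_def)
  have learner: "MLE_learner Z C models P"
    unfolding MLE_learner_def
    using dist P_0 models unfolding distribution_def by metis
  have N: "N_plus Z C P = n"
  proof -
    have "card {z \<in> Z. P c z > 0} = n" if "c \<in> C" for c
    proof -
      have "{z \<in> Z. P c z > 0} = G c" using pos_iff G(1) that by auto
      then show ?thesis using G(2) that by simp
    qed
    then have "(\<lambda>c. card {z \<in> Z. P c z > 0}) ` C = {n}" using C by auto
    then show ?thesis unfolding N_plus_def by simp
  qed
  have high: "1/2 < sample_lik (P c) (T c)" if c: "c \<in> C" for c
  proof (rule distribution.sample_lik_gt_half[OF dist[OF c], where q = "M / W c"])
    show "T c \<subseteq> Z" using T(1) G(1) c by blast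
    show "0 < M / W c" using M W c by simp
    show "P c z = M / W c" if "z \<in> T c" for z using that by (simp add: P_def w_def)
    have "real (card (T c)) * (n - card (T c)) \<le> real n * real n"
      using cardT[OF c] by (intro mult_mono) auto
    then have "2 * real (card (T c)) * (n - card (T c)) < M"
      by (simp add: M_def power2_eq_square)
    moreover have "1 - card (T c) * (M / W c) = (n - card (T c)) / W c"
      using W_eq[OF c] W[OF c] by (simp add: field_simps)
    ultimately show "2 * real (card (T c)) * (1 - card (T c) * (M / W c)) < M / W c"
      using W[OF c] by (simp add: divide_strict_right_mono)
  qed
  have low: "sample_lik (P c) (T c0) \<le> 1/2" if c: "c \<in> C" "c0 \<in> C" "c \<noteq> c0" for c c0
  proof (cases "T c0 \<subseteq> G c")
    case False
    then obtain a where "a \<in> T c0" "a \<notin> G c" by auto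
    then show ?thesis using sample_lik_eq_0[of a "T c0" "P c"] P_0 c by simp
  next
    case True
    have ne: "T c0 \<noteq> T c" using T(3) c by (auto dest: inj_onD)
    obtain a t where at: "a \<in> T c0" "t \<in> G c - T c0" "w c a \<le> w c t"
    proof (cases "T c \<subseteq> T c0")
      \<comment> \<open>Some \<open>t\<close> in \<open>T c\<close> outside \<open>T c0\<close> has
        the maximal weight \<open>M\<close>, so any \<open>a\<close> in \<open>T c0\<close> will
        do.\<close>
      case False
      then obtain t where "t \<in> T c" "t \<notin> T c0" by auto
      moreover obtain a where "a \<in> T c0" using T(2) c by blast
      moreover have "t \<in> G c" using T(1)[OF c(1)] \<open>t \<in> T c\<close> by blast
      ultimately show ?thesis using that[of a t] M by (auto simp: w_def)
    next
      \<comment> \<open>Elements of \<open>T c0\<close> outside \<open>T c\<close> weigh at most 1,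
        the weight of any \<open>t\<close> in \<open>G c - T c0\<close>. Such a \<open>t\<close>
        exists: otherwise \<open>G c = T c0\<close> would lie in \<open>G c0\<close>, and equal
        sizes would give \<open>G c = G c0\<close>.\<close>
      case sub: True
      then obtain a where a: "a \<in> T c0" "a \<notin> T c" using ne by auto
      have "T c0 \<noteq> G c"
      proof
        assume eq: "T c0 = G c"
        then have "G c = G c0"
          using T(1)[of c0] G(2) finG c by (intro card_subset_eq) auto
        then show False using G(3) c by (auto dest: inj_onD)
      qed
      then obtain t where "t \<in> G c" "t \<notin> T c0" using True by auto
      then show ?thesis using that[of a t] a M by (auto simp: w_def)
    qed
    show ?thesis
    proof (rule distribution.sample_lik_le_half[OF dist[OF c(1)]])
      show "T c0 \<subseteq> Z" using True G(1) c by blast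
      show "a \<in> T c0" by (rule at)
      show "t \<in> Z - T c0" using at G(1) c by blast
      show "P c a \<le> P c t" using at(3) W[OF c(1)] by (simp add: P_def divide_right_mono)
    qed
  qed
  have "teacher Z C P T"
    unfolding teacher_def
  proof (intro ballI conjI)
    fix c0 assume c0: "c0 \<in> C"
    show "T c0 \<subseteq> Z" using T(1) G(1) c0 by blast
    show "card (T c0) \<le> N_plus Z C P" using N cardT c0 by simp
    have less: "sample_lik (P c) (T c0) < sample_lik (P c0) (T c0)" if "c \<in> C" "c \<noteq> c0" for c
      using low[OF that(1) c0 that(2)] high[OF c0] by linarith
    then show "{c. is_arg_max (\<lambda>c. sample_lik (P c) (T c0)) (\<lambda>c. c \<in> C) c} = {c0}"
      using c0 unfolding is_arg_max_def by (auto dest: less_asym)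
  qed
  with learner show ?thesis by (rule that)
qed

section \<open>An injective map to small consistent samples\<close>

text \<open>Both members of a pair lie in \<open>C\<close>, so the label of \<open>x\<close> can be
  chosen freely. This makes the VC-dimension of the class of pairs drop by one.\<close>

lemma shatters_insert:
  assumes "shatters {c \<in> C. x \<notin> c \<and> insert x c \<in> C} S" "x \<notin> S"
  shows "shatters C (insert x S)"
  unfolding shatters_def
proof
  fix b
  obtain c where c: "c \<in> C" "x \<notin> c" "insert x c \<in> C" "\<forall>y\<in>S. b y \<longleftrightarrow> y \<in> c"
    using assms(1) unfolding shatters_def by blast
  show "\<exists>c\<in>C. \<forall>y\<in>insert x S. b y \<longleftrightarrow> y \<in> c"
  proof (cases "b x")
    case True
    then show ?thesis using c assms(2) by (intro bexI[of _ "insert x c"]) auto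
  next
    case False
    then show ?thesis using c by (intro bexI[of _ c]) auto
  qed
qed

lemma shatters_projection:
  assumes "shatters ((\<lambda>c. c - {x}) ` C) S" "x \<notin> S"
  shows "shatters C S"
  unfolding shatters_def
proof
  fix b
  obtain c where "c \<in> C" "\<forall>y\<in>S. b y \<longleftrightarrow> y \<in> c - {x}"
    using assms(1) unfolding shatters_def by blast
  then show "\<exists>c\<in>C. \<forall>y\<in>S. b y \<longleftrightarrow> y \<in> c" using assms(2) by (intro bexI[of _ c]) auto
qed

text \<open>Any point on which the two concepts differ works. Thus VC-dimension 0 leaves at most one
  concept.\<close>

lemma ex_shattered_singleton:
  assumes "c \<in> C" "c' \<in> C" "c \<noteq> c'" "C \<subseteq> Pow X"
  obtains x where "x \<in> X" "shatters C {x}"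
proof -
  obtain x where x: "(x \<in> c) \<noteq> (x \<in> c')" using assms(3) by blast
  then have "x \<in> X" using assms by blast
  moreover have "shatters C {x}"
    unfolding shatters_def using x assms(1,2) by (metis singletonD)
  ultimately show ?thesis by (rule that)
qed

text \<open>These are exactly the labeled examples over \<open>X\<close> that are consistent with
  \<open>c\<close>.\<close>

definition graph_on :: "'a set \<Rightarrow> 'a set \<Rightarrow> ('a \<times> bool) set" where
  "graph_on X c = (\<lambda>x. (x, x \<in> c)) ` X"

lemma inj_on_graph_on: "inj_on (graph_on X) (Pow X)"
proof (rule inj_on_inverseI)
  show "{x. (x, True) \<in> graph_on X c} = c" if "c \<in> Pow X" for c
    using that by (auto simp: graph_on_def)
qed

text \<open>A free bound \<open>d\<close> lets the induction pass to \<open>d - 1\<close>.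
  Nonemptiness is claimed only for \<open>0 < d\<close>: in the recursive use with
  \<open>d - 1 = 0\<close> empty samples are harmless, as \<open>(x, True)\<close> is added to
  them.\<close>

lemma ex_injective_samples:
  assumes "finite X" "X \<noteq> {}" "C \<subseteq> Pow X" "\<And>S. S \<subseteq> X \<Longrightarrow> shatters C S \<Longrightarrow> card S \<le> d"
  shows "\<exists>T. inj_on T C \<and> (\<forall>c\<in>C. T c \<subseteq> graph_on X c \<and> card (T c) \<le> d \<and> (0 < d \<longrightarrow> T c \<noteq> {}))"
  using assms
proof (induction X arbitrary: C d rule: finite_induct)
  case empty
  then show ?case by simp
next
  case (insert x X)
  note VC = insert.prems(3)
  show ?case
  proof (cases "d = 0")
    case True
    have "c = c'" if c: "c \<in> C" "c' \<in> C" for c c'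
    proof (rule ccontr)
      assume "c \<noteq> c'"
      then obtain y where "y \<in> insert x X" "shatters C {y}"
        using ex_shattered_singleton[OF c \<open>c \<noteq> c'\<close> insert.prems(2)] by blast
      then show False using VC[of "{y}"] True by simp
    qed
    then show ?thesis using True
      by (intro exI[of _ "\<lambda>_. {}"]) (auto simp: inj_on_def)
  next
    case d: False
    show ?thesis
    proof (cases "X = {}")
      case True
      \<comment> \<open>The domain is the single point \<open>x\<close>, so the whole graph is a
        sample of size 1. The induction hypothesis excludes the empty domain.\<close>
      have "card (graph_on (insert x X) c) \<le> d \<and> graph_on (insert x X) c \<noteq> {}" for c
        using True d by (simp add: graph_on_def)
      then show ?thesis
        using inj_on_subset[OF inj_on_graph_on insert.prems(2)] by blast
    next
      case False
      define D where "D = (\<lambda>c. c - {x}) ` C"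
      define E where "E = {c \<in> C. x \<notin> c \<and> insert x c \<in> C}"
      have "D \<subseteq> Pow X" using insert.prems(2) by (auto simp: D_def)
      moreover have "card S \<le> d" if "S \<subseteq> X" "shatters D S" for S
        using VC[of S] that insert.hyps shatters_projection[of x C S] by (auto simp: D_def)
      ultimately obtain T where T: "inj_on T D" "\<forall>c\<in>D. T c \<subseteq> graph_on X c \<and> card (T c) \<le> d \<and> T c \<noteq> {}"
        using insert.IH[of D d] False d by auto
      have "E \<subseteq> Pow X" using insert.prems(2) by (auto simp: E_def)
      moreover have "card S \<le> d - 1" if "S \<subseteq> X" "shatters E S" for S
      proof -
        have "x \<notin> S" "finite S" using that insert.hyps finite_subset by auto
        then have "Suc (card S) \<le> d"
          using VC[of "insert x S"] that shatters_insert[of C x S] by (auto simp: E_def)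
        then show ?thesis by simp
      qed
      ultimately obtain T' where T': "inj_on T' E" "\<forall>c\<in>E. T' c \<subseteq> graph_on X c \<and> card (T' c) \<le> d - 1"
        using insert.IH[of E "d - 1"] False by blast
      have graph: "graph_on X (c - {x}) \<subseteq> graph_on (insert x X) c" for c
        using insert.hyps by (auto simp: graph_on_def)
      have x_notin: "(x, b) \<notin> graph_on X c" for b c
        using insert.hyps by (auto simp: graph_on_def)
      define paired where "paired c \<longleftrightarrow> x \<in> c \<and> c - {x} \<in> C" for c
      define U where "U c = (if paired c then Set.insert (x, True) (T' (c - {x})) else T (c - {x}))" for c
      have inD: "c - {x} \<in> D" if "c \<in> C" for c using that by (auto simp: D_def)
      have inE: "c - {x} \<in> E" if "c \<in> C" "paired c" for c
        using that by (auto simp: E_def paired_def insert_absorb)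
      \<comment> \<open>The recursive samples avoid \<open>x\<close>, so the example
        \<open>(x, True)\<close> separates the two kinds of concepts.\<close>
      have x_in_U: "(x, True) \<in> U c \<longleftrightarrow> paired c" if "c \<in> C" for c
        using T(2) inD[OF that] x_notin by (auto simp: U_def)
      have "inj_on U C"
      proof (rule inj_onI)
        fix c c' assume c: "c \<in> C" "c' \<in> C" "U c = U c'"
        then have iff: "paired c \<longleftrightarrow> paired c'" using x_in_U by metis
        show "c = c'"
        proof (cases "paired c")
          case True
          have "(x, True) \<notin> T' (c - {x})" "(x, True) \<notin> T' (c' - {x})"
            using T'(2) inE c True iff x_notin by blast+
          then have "T' (c - {x}) = T' (c' - {x})"
            using c(3) True iff by (auto simp: U_def insert_ident)
          then have "c - {x} = c' - {x}" using T'(1) inE c True iff by (metis inj_onD)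
          then show ?thesis using True iff by (auto simp: paired_def)
        next
          case False
          then have "T (c - {x}) = T (c' - {x})" using c(3) iff by (simp add: U_def)
          then have eq: "c - {x} = c' - {x}" using T(1) inD c by (metis inj_onD)
          \<comment> \<open>If only one of \<open>c\<close> and \<open>c'\<close> contained
            \<open>x\<close>, the other would be its partner in \<open>C\<close>, making it
            paired.\<close>
          have "x \<in> c \<longleftrightarrow> x \<in> c'"
            using eq False iff c(1,2) by (metis Diff_empty Diff_insert0 paired_def)
          then show ?thesis using eq by auto
        qed
      qed
      moreover have "U c \<subseteq> graph_on (insert x X) c \<and> card (U c) \<le> d \<and> U c \<noteq> {}" if c: "c \<in> C" for c
      proof (cases "paired c")
        case True
        have "T' (c - {x}) \<subseteq> graph_on (insert x X) c" "card (T' (c - {x})) \<le> d - 1"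
          using T'(2) inE[OF c True] graph by blast+
        moreover have "(x, True) \<in> graph_on (insert x X) c"
          using True by (auto simp: graph_on_def paired_def)
        ultimately show ?thesis
          using True d card_insert_le_m1[of d "T' (c - {x})" "(x, True)"] by (simp add: U_def)
      next
        case False
        then show ?thesis using T(2) inD[OF c] graph by (fastforce simp: U_def)
      qed
      ultimately show ?thesis by blast
    qed
  qed
qed

section \<open>Conclusion for the VC-dimension\<close>

lemma card_le_VCdim:
  assumes "finite X" "S \<subseteq> X" "shatters C S"
  shows "card S \<le> VCdim X C"
proof -
  have "finite {card S | S. S \<subseteq> X \<and> shatters C S}" using assms(1) by simp
  then show ?thesis unfolding VCdim_def using assms by (intro Max_ge) auto
qed

theorem corollary5p11:
  fixes X :: "'a set" and C :: "'a set set"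
  assumes "finite X" and "X \<noteq> {}" and "C \<subseteq> Pow X" and "card C \<ge> 2"
  shows "MLE_TD (labeled_examples X) C consistent \<le> enat (VCdim X C)"
proof -
  have C: "finite C" "C \<noteq> {}"
    using assms by (auto intro: finite_subset)
  obtain c c' where "c \<in> C" "c' \<in> C" "c \<noteq> c'"
    using assms(4) C by (metis card_le_Suc0_iff_eq not_less_eq_eq numeral_2_eq_2)
  then obtain y where "y \<in> X" "shatters C {y}"
    using ex_shattered_singleton[OF _ _ _ assms(3)] by blast
  \<comment> \<open>Positivity is what guarantees nonempty samples; it comes from having two
    distinct concepts.\<close>
  then have "0 < VCdim X C"
    using card_le_VCdim[of X "{y}" C] assms(1) by simp
  then obtain T where T: "inj_on T C" "\<And>c. c \<in> C \<Longrightarrow> T c \<subseteq> graph_on X c"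
      "\<And>c. c \<in> C \<Longrightarrow> T c \<noteq> {}" "\<And>c. c \<in> C \<Longrightarrow> card (T c) \<le> VCdim X C"
    using ex_injective_samples[OF assms(1-3) card_le_VCdim[OF assms(1)]] by metis
  obtain P where P: "MLE_learner (labeled_examples X) C consistent P"
      "teacher (labeled_examples X) C P T"
  proof (rule injective_map_is_teacher[where Z = "labeled_examples X" and G = "graph_on X"
        and n = "card X" and C = C and T = T and models = consistent])
    show "finite (labeled_examples X)" using assms(1) by (simp add: labeled_examples_def)
    show "graph_on X c \<subseteq> labeled_examples X" for c
      by (auto simp: graph_on_def labeled_examples_def)
    show "card (graph_on X c) = card X" for c
      unfolding graph_on_def by (intro card_image) (auto simp: inj_on_def)
    show "inj_on (graph_on X) C"
      by (rule inj_on_subset[OF inj_on_graph_on assms(3)])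
    show "consistent c z" if "z \<in> graph_on X c" for c z
      using that by (auto simp: graph_on_def consistent_def)
  qed (use C T in auto)
  have "MLE_TD (labeled_examples X) C consistent \<le> enat (teacher_order C T)"
    unfolding MLE_TD_def using P by (intro Inf_lower) blast
  also have "\<dots> \<le> enat (VCdim X C)"
    using C T(4) by (simp add: teacher_order_def)
  finally show ?thesis .
qed

end
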